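(* Let $\alpha\in\mathbb{C}$ and $H_3(q,p,t;\alpha)=\dfrac{q^2p^2+\alpha qp+q}{2t}$. The system $$\frac{dq}{dt}=\frac{\partial H_3}{\partial p},\qquad \frac{dp}{dt}=-\frac{\partial H_3}{\partial q}$$ has the first integral $I_3=q^2p^2+\alpha qp+q$.
   Context: A first integral is a function of $(q,p)$ that is constant along every solution of the system. *)

theory Defs
  imports "HOL-Analysis.Analysis"
begin

text \<open>
  Time is complex: a solution lives on a domain (open connected set) of the complex plane.
  The set \<open>T\<close> collects the times at which the Hamiltonian \<open>H q p t\<close> is defined; it has to be
  given explicitly because division by zero is total in HOL.  The operator \<open>deriv\<close> is the complex
  derivative, here taken in one variable with the others held fixed; it is meaningful as a partial
  derivative for Hamiltonians that are differentiable in \<open>q\<close> and in \<open>p\<close>.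
\<close>

definition hamiltonian_solution ::
  "complex set \<Rightarrow> (complex \<Rightarrow> complex \<Rightarrow> complex \<Rightarrow> complex) \<Rightarrow>
   complex set \<Rightarrow> (complex \<Rightarrow> complex) \<Rightarrow> (complex \<Rightarrow> complex) \<Rightarrow> bool" where
  "hamiltonian_solution T H D q p \<longleftrightarrow>
     open D \<and> connected D \<and> D \<subseteq> T \<and>
     (\<forall>t\<in>D. (q has_field_derivative deriv (\<lambda>y. H (q t) y t) (p t)) (at t) \<and>
            (p has_field_derivative - deriv (\<lambda>x. H x (p t) t) (q t)) (at t))"

definition first_integral ::
  "complex set \<Rightarrow> (complex \<Rightarrow> complex \<Rightarrow> complex \<Rightarrow> complex) \<Rightarrow>
   (complex \<Rightarrow> complex \<Rightarrow> complex) \<Rightarrow> bool" where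
  "first_integral T H F \<longleftrightarrow>
     (\<forall>D q p. hamiltonian_solution T H D q p \<longrightarrow> (\<lambda>t. F (q t) (p t)) constant_on D)"

definition H3 :: "complex \<Rightarrow> complex \<Rightarrow> complex \<Rightarrow> complex \<Rightarrow> complex" where
  "H3 \<alpha> q p t = (q\<^sup>2 * p\<^sup>2 + \<alpha> * q * p + q) / (2 * t)"

definition I3 :: "complex \<Rightarrow> complex \<Rightarrow> complex \<Rightarrow> complex" where
  "I3 \<alpha> q p = q\<^sup>2 * p\<^sup>2 + \<alpha> * q * p + q"

end

theory Submission
  imports Defs
begin

text \<open>
  The Hamiltonian is \<open>H3 \<alpha> q p t = I3 \<alpha> q p / (2 * t)\<close>: time enters only through a scalar factor.
  Hamilton's equations therefore make \<open>(q, p)\<close> move with velocity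
  \<open>(\<partial>I3/\<partial>p, - \<partial>I3/\<partial>q) / (2 * t)\<close>, so the chain rule gives for the rate of change of \<open>I3\<close>
  along a solution \<open>(\<partial>I3/\<partial>q * \<partial>I3/\<partial>p - \<partial>I3/\<partial>p * \<partial>I3/\<partial>q) / (2 * t) = 0\<close>, the Poisson bracket
  of \<open>I3\<close> with itself up to the factor.  A function with zero derivative on a connected open set
  is constant.
\<close>

lemma deriv_H3_momentum:
  assumes "t \<noteq> 0"
  shows "deriv (\<lambda>y. H3 \<alpha> x y t) y = (2 * x\<^sup>2 * y + \<alpha> * x) / (2 * t)"
  unfolding H3_def using assms
  by (intro DERIV_imp_deriv) (auto intro!: derivative_eq_intros simp: field_simps)

lemma deriv_H3_position:
  assumes "t \<noteq> 0"
  shows "deriv (\<lambda>x. H3 \<alpha> x y t) x = (2 * x * y\<^sup>2 + \<alpha> * y + 1) / (2 * t)"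
  unfolding H3_def using assms
  by (intro DERIV_imp_deriv) (auto intro!: derivative_eq_intros simp: field_simps)

lemma has_field_derivative_I3:
  assumes "(q has_field_derivative q') (at t)" and "(p has_field_derivative p') (at t)"
  shows "((\<lambda>t. I3 \<alpha> (q t) (p t)) has_field_derivative
           (2 * q t * (p t)\<^sup>2 + \<alpha> * p t + 1) * q' + (2 * (q t)\<^sup>2 * p t + \<alpha> * q t) * p') (at t)"
  unfolding I3_def
  by (rule derivative_eq_intros assms refl)+ (simp add: algebra_simps)

theorem proposition4p1:
  fixes \<alpha> :: complex
  shows "first_integral (- {0}) (H3 \<alpha>) (I3 \<alpha>)"
  unfolding first_integral_def
proof (intro allI impI)
  fix D q p
  assume sol: "hamiltonian_solution (- {0}) (H3 \<alpha>) D q p"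
  show "(\<lambda>t. I3 \<alpha> (q t) (p t)) constant_on D"
  proof (rule has_field_derivative_0_imp_constant_on)
    fix t assume t: "t \<in> D"
    with sol have "t \<noteq> 0"
      by (auto simp: hamiltonian_solution_def)
    let ?Iq = "2 * q t * (p t)\<^sup>2 + \<alpha> * p t + 1" and ?Ip = "2 * (q t)\<^sup>2 * p t + \<alpha> * q t"
    have "(q has_field_derivative ?Ip / (2 * t)) (at t)"
      and "(p has_field_derivative - (?Iq / (2 * t))) (at t)"
      using sol t unfolding hamiltonian_solution_def
      by (simp_all flip: deriv_H3_momentum[OF \<open>t \<noteq> 0\<close>] deriv_H3_position[OF \<open>t \<noteq> 0\<close>])
    from has_field_derivative_I3[OF this, of \<alpha>]
    show "((\<lambda>t. I3 \<alpha> (q t) (p t)) has_field_derivative 0) (at t)"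
      by (simp add: mult.commute)
  qed (use sol in \<open>simp_all add: hamiltonian_solution_def\<close>)
qed

end
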